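(* If $\beta$ is a real number such that $\beta\ge 2$, then the function $p_\beta:\mathbb{R}_+\to\mathbb{R}$, $x\mapsto x^\beta$, belongs to the class $\mathcal{F}$.
   Context: $\mathbb{N}=\{0,1,2,\dots\}$ and $\mathbb{R}_+=[0,\infty)$. The class $\mathcal{F}$ consists of all real-valued functions $f$ whose domain contains $\mathbb{N}$ and such that $f(0)=0$, $f(k+2)-f(k+1)>f(k+1)-f(k)$ for all $k\in\mathbb{N}$, and $(k-2)f(k)\ge k\,(f(k-1)-f(1))$ for all integers $k\ge 3$. *)

theory Defs
  imports Complex_Main "HOL-Library.FuncSet"
begin

(* The functions of the class F with domain D, where D is a set of reals.  A function with domain D
   is represented, as usual, by a total function that is undefined outside D; the naturals lie
   in D, so the conditions only evaluate f inside its domain. *)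
definition class_F :: "real set \<Rightarrow> (real \<Rightarrow> real) set" where
  "class_F D = {f \<in> D \<rightarrow>\<^sub>E UNIV.
     \<nat> \<subseteq> D \<and>
     f 0 = 0 \<and>
     (\<forall>k::nat. f (real k + 2) - f (real k + 1) > f (real k + 1) - f (real k)) \<and>
     (\<forall>k::int. k \<ge> 3 \<longrightarrow>
        (real_of_int k - 2) * f (real_of_int k)
          \<ge> real_of_int k * (f (real_of_int k - 1) - f 1))}"

definition p :: "real \<Rightarrow> real \<Rightarrow> real" where
  "p \<beta> = (\<lambda>x\<in>{0..}. x powr \<beta>)"

end

theory Submission
  imports Defs "HOL-Analysis.Convex"
begin

text \<open>Both defining inequalities come from the convexity of \<open>x powr a\<close> for \<open>a \<ge> 1\<close>.
  For the strict one, put \<open>a = \<beta> / 2\<close> and take the midpoint of \<open>k\<^sup>2\<close> and \<open>(k + 2)\<^sup>2\<close>, which is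
  \<open>(k + 1)\<^sup>2 + 1\<close>. For the other one, put \<open>a = \<beta> - 1\<close> and observe that \<open>k - 1\<close> is the mean of
  \<open>k\<close> and \<open>1\<close> with weights \<open>(k - 2) / (k - 1)\<close> and \<open>1 / (k - 1)\<close>.\<close>

lemma powr_strictly_midconvex:
  fixes x \<beta> :: real
  assumes "x \<ge> 0" "\<beta> \<ge> 2"
  shows "2 * (x + 1) powr \<beta> < (x + 2) powr \<beta> + x powr \<beta>"
proof (cases "x = 0")
  case True
  \<comment> \<open>Since \<open>0 powr \<beta> = 0\<close>, the claim at \<open>x = 0\<close> is
    \<open>2 < 2 powr \<beta>\<close>.\<close>
  have "(2::real) powr 1 < 2 powr \<beta>"
    using assms by (intro powr_less_mono) auto
  then show ?thesis
    using True by simp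
next
  case False
  have sq: "(y\<^sup>2) powr (\<beta> / 2) = y powr \<beta>" if "y \<ge> 0" for y :: real
    using that by (cases "y = 0") (auto simp flip: powr_numeral simp: powr_powr)
  have "(x + 1) powr \<beta> = ((x + 1)\<^sup>2) powr (\<beta> / 2)"
    using sq[of "x + 1"] assms by simp
  \<comment> \<open>The surplus \<open>1\<close> gives strictness; the convexity step needs only
    \<open>\<beta> / 2 \<ge> 1\<close>.\<close>
  also have "\<dots> < ((x + 1)\<^sup>2 + 1) powr (\<beta> / 2)"
    using assms by (intro powr_less_mono2) auto
  also have "(x + 1)\<^sup>2 + 1 = (1 - 1 / 2) *\<^sub>R x\<^sup>2 + (1 / 2) *\<^sub>R (x + 2)\<^sup>2"
    by (simp add: power2_eq_square algebra_simps)
  also have "\<dots> powr (\<beta> / 2) \<le> (1 - 1 / 2) * (x\<^sup>2) powr (\<beta> / 2) + (1 / 2) * ((x + 2)\<^sup>2) powr (\<beta> / 2)"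
    using assms False by (intro convex_onD[OF powr_convex]) auto
  also have "\<dots> = (x powr \<beta> + (x + 2) powr \<beta>) / 2"
    using sq[of x] sq[of "x + 2"] assms by simp
  finally show ?thesis by simp
qed

text \<open>Convexity yields \<open>(x - 1) powr \<beta> \<le> (x - 2) * x powr (\<beta> - 1) +
  1\<close>; multiplying by \<open>x\<close> restores the exponent.\<close>

lemma powr_minus_one_bound:
  fixes x \<beta> :: real
  assumes "x \<ge> 2" "\<beta> \<ge> 2"
  shows "x * ((x - 1) powr \<beta> - 1) \<le> (x - 2) * x powr \<beta>"
proof -
  define t where "t = 1 / (x - 1)"
  have t: "0 \<le> t" "t \<le> 1" "(x - 1) * t = 1" "(x - 1) * (1 - t) = x - 2"
    using assms by (auto simp: t_def field_simps)
  have split: "y powr \<beta> = y * y powr (\<beta> - 1)" if "y > 0" for y :: real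
    using that by (simp add: powr_mult_base)
  have "(x - 1) * (x - 1) = (x - 1) * ((1 - t) * x + t)"
    using t by (simp add: distrib_left flip: mult.assoc) (simp add: algebra_simps)
  then have mean: "x - 1 = (1 - t) * x + t"
    using assms by simp
  \<comment> \<open>The split-off factor \<open>x - 1\<close> cancels the denominator of both
    weights.\<close>
  have "(x - 1) powr \<beta> = (x - 1) * ((1 - t) *\<^sub>R x + t *\<^sub>R 1) powr (\<beta> - 1)"
    using split[of "x - 1"] mean assms by simp
  also have "\<dots> \<le> (x - 1) * ((1 - t) * x powr (\<beta> - 1) + t * 1 powr (\<beta> - 1))"
    using assms t by (intro mult_left_mono convex_onD[OF powr_convex]) auto
  also have "\<dots> = (x - 2) * x powr (\<beta> - 1) + 1"
    using t by (simp add: distrib_left flip: mult.assoc)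
  finally have "x * ((x - 1) powr \<beta> - 1) \<le> x * ((x - 2) * x powr (\<beta> - 1))"
    using assms by (intro mult_left_mono) auto
  also have "\<dots> = (x - 2) * x powr \<beta>"
    using split[of x] assms by simp
  finally show ?thesis .
qed

theorem theorem6:
  fixes \<beta> :: real
  assumes "\<beta> \<ge> 2"
  shows "p \<beta> \<in> class_F {0..}"
proof -
  have "p \<beta> (real k + 2) - p \<beta> (real k + 1) > p \<beta> (real k + 1) - p \<beta> (real k)" for k :: nat
    using powr_strictly_midconvex[of "real k" \<beta>] assms by (simp add: p_def)
  moreover have "(real_of_int k - 2) * p \<beta> (real_of_int k)
      \<ge> real_of_int k * (p \<beta> (real_of_int k - 1) - p \<beta> 1)" if "k \<ge> 3" for k :: int
    \<comment> \<open>As \<open>k - 1 \<ge> 0\<close>, all arguments lie in \<open>{0..}\<close>,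
      where \<open>p \<beta>\<close> is \<open>powr\<close>; the \<open>1\<close> subtracted in the
      bound is \<open>p \<beta> 1\<close>.\<close>
    using powr_minus_one_bound[of "real_of_int k" \<beta>] assms that by (simp add: p_def)
  moreover have "p \<beta> \<in> {0..} \<rightarrow>\<^sub>E UNIV" "p \<beta> 0 = 0" "\<nat> \<subseteq> {0 :: real..}"
    by (auto simp: p_def Nats_def)
  ultimately show ?thesis
    unfolding class_F_def by blast
qed

end
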